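(* Let $n\ge 1$ be an integer, let $I\subset[0,\infty)$ be an interval, and let $f:I\to\mathbb{R}$ be an $n$-times differentiable function on $I^\circ$ such that $f^{(n)}\in L^1[a,b]$, where $a,b\in I$, $a<b$. Let $p,q$ be conjugate numbers where $q\ge 1$ and $p=\frac{q}{q-1}$. If $|f^{(n)}|^q$ is concave on $[a,b]$, then $$\left|\sum_{m=1}^n(-1)^{n-m+2}\frac{(b-a)^m}{2\cdot(m!)}\left[f^{(m-1)}(b)-(-1)^m f^{(m-1)}(a)\right]+(-1)^n\int_a^b f(x)\,dx\right|$$ $$\le\frac{(b-a)^{n+1}}{n!}\left(\frac{1}{np+1}\right)^{\frac1p}\left|f^{(n)}\left(\frac{a+b}{2}\right)\right|=\frac{(b-a)^{n+1}}{n!}\left(\beta(np+1,1)\right)^{\frac1p}\left|f^{(n)}\left(\frac{a+b}{2}\right)\right|.$$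
   Context: $I^\circ$ denotes the interior of $I$. The Beta function is $\beta(x,y)=\int_0^1 t^{x-1}(1-t)^{y-1}\,dt$ for $x,y>0$. It is understood that $f$ is $n$ times differentiable at every point of $[a,b]$ (one-sided at a point that is an endpoint of $I$), so that $f^{(n)}$ is defined on all of $[a,b]$; $f^{(0)}=f$. When $q=1$ (so $p=\infty$), the factors $(1/(np+1))^{1/p}$ and $(\beta(np+1,1))^{1/p}$ are read as their limit $1$. *)

theory Defs
  imports "HOL-Analysis.Analysis" "HOL-Real_Asymp.Real_Asymp"
begin

(* The derivatives are relative to S: two-sided at interior points of S and one-sided at an
   endpoint of S belonging to S.  Where a derivative fails to exist the value is unspecified,
   so differentiability has to be assumed separately. *)
primrec nderiv_within :: "nat \<Rightarrow> real set \<Rightarrow> (real \<Rightarrow> real) \<Rightarrow> real \<Rightarrow> real" where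
  "nderiv_within 0 S f = f"
| "nderiv_within (Suc k) S f = (\<lambda>x. vector_derivative (nderiv_within k S f) (at x within S))"

(* A condition at the single point x: that the lower derivatives exist near x is not part of it.
   It is meant to be required throughout a subset of S that is open in S. *)
definition n_times_differentiable_at_within ::
  "nat \<Rightarrow> (real \<Rightarrow> real) \<Rightarrow> real \<Rightarrow> real set \<Rightarrow> bool" where
  "n_times_differentiable_at_within n f x S \<longleftrightarrow>
     (\<forall>k<n. nderiv_within k S f differentiable (at x within S))"

lemma nderiv_within_interior:
  assumes "x \<in> interior S"
  shows "nderiv_within k S f x = (deriv ^^ k) f x"
  using assms
proof (induction k arbitrary: x)
  case 0
  show ?case by simp
next
  case (Suc k)
  have ev: "\<forall>\<^sub>F y in nhds x. nderiv_within k S f y = (deriv ^^ k) f y"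
    using eventually_nhds_in_open[OF open_interior Suc.prems]
    by eventually_elim (rule Suc.IH)
  have "(nderiv_within k S f has_vector_derivative D) (at x within S) \<longleftrightarrow>
        ((deriv ^^ k) f has_field_derivative D) (at x)" for D
  proof -
    have "(nderiv_within k S f has_vector_derivative D) (at x within S) \<longleftrightarrow>
          (nderiv_within k S f has_field_derivative D) (at x)"
      by (simp add: at_within_interior[OF Suc.prems] has_real_derivative_iff_has_vector_derivative)
    also have "\<dots> \<longleftrightarrow> ((deriv ^^ k) f has_field_derivative D) (at x)"
      by (rule DERIV_cong_ev[OF refl ev refl])
    finally show ?thesis .
  qed
  then show ?case
    by (simp add: vector_derivative_def deriv_def[of "(deriv ^^ k) f"])
qed

(* The conjugate exponent p = q / (q - 1), an extended real since q = 1 gives p = \<infinity>. *)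
definition conjugate_exponent :: "real \<Rightarrow> ereal" where
  "conjugate_exponent q = (if q = 1 then \<infinity> else ereal (q / (q - 1)))"

(* (1 / (n p + 1)) ^ (1 / p) and Beta (n p + 1, 1) ^ (1 / p), read as their limits as p tends to
   infinity (computed below) when p = \<infinity>.  The integral formula for Beta is
   has_integral_Beta_real. *)
definition power_factor :: "nat \<Rightarrow> ereal \<Rightarrow> real" where
  "power_factor n p =
     (if p = \<infinity> then 1
      else (1 / (real n * real_of_ereal p + 1)) powr (1 / real_of_ereal p))"

definition Beta_factor :: "nat \<Rightarrow> ereal \<Rightarrow> real" where
  "Beta_factor n p =
     (if p = \<infinity> then 1
      else (Beta (real n * real_of_ereal p + 1) 1) powr (1 / real_of_ereal p))"

lemma power_factor_tendsto:
  "((\<lambda>p. power_factor n (ereal p)) \<longlongrightarrow> power_factor n \<infinity>) at_top"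
proof (cases "n = 0")
  case True
  then show ?thesis by (simp add: power_factor_def)
next
  case False
  have "((\<lambda>p. (1 / (r * p + 1)) powr (1 / p)) \<longlongrightarrow> 1) at_top" if "r > 0" for r :: real
    using that by real_asymp
  from this[of "real n"] False show ?thesis by (simp add: power_factor_def)
qed

lemma Beta_factor_tendsto:
  "((\<lambda>p. Beta_factor n (ereal p)) \<longlongrightarrow> Beta_factor n \<infinity>) at_top"
proof -
  have "Beta (real n * p + 1) 1 = 1 / (real n * p + 1)" if "p > 0" for p
  proof -
    have pos: "real n * p + 1 > 0" using that by (simp add: add_nonneg_pos)
    have "real n * p + 1 \<notin> \<int>\<^sub>\<le>\<^sub>0" using pos by auto
    from Gamma_plus1[OF this] have "Gamma (real n * p + 1 + 1) = (real n * p + 1) * Gamma (real n * p + 1)" .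
    moreover have "Gamma (real n * p + 1) > 0" using pos by (rule Gamma_real_pos)
    ultimately show ?thesis unfolding Beta_def by simp
  qed
  then have "\<forall>\<^sub>F p in at_top. power_factor n (ereal p) = Beta_factor n (ereal p)"
    by (intro eventually_mono[OF eventually_gt_at_top[of "0::real"]])
       (simp add: power_factor_def Beta_factor_def)
  from Lim_transform_eventually[OF power_factor_tendsto this] show ?thesis
    by (simp add: power_factor_def Beta_factor_def)
qed

end

theory Submission
  imports Defs
begin

text \<open>
  Expand a primitive \<open>F\<close> of \<open>f\<close> by Taylor's formula with integral remainder, once from \<open>a\<close> to \<open>b\<close>
  and once from \<open>b\<close> to \<open>a\<close>. Half the difference of the two expansions is the left-hand side, up to
  the sign \<open>(-1) ^ n\<close>. After the substitution \<open>t \<mapsto> a + b - t\<close> in one of them, the two remainders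
  share the kernel \<open>(b - t) ^ n\<close>, so the left-hand side is the absolute value of
  \[
    \frac{1}{2\, n!} \int_a^b (b - t)^n \bigl(g(t) + (-1)^n g(a + b - t)\bigr)\,dt,
    \qquad g = f^{(n)}.
  \]
  This is lemma \<open>two_sided_Taylor_has_integral\<close>.

  The points \<open>t\<close> and \<open>a + b - t\<close> are symmetric about the midpoint \<open>c\<close> of \<open>[a, b]\<close>. Concavity of
  \<open>\<bar>g\<bar> powr q\<close> together with convexity of \<open>x powr q\<close> gives
  \<open>\<bar>g t\<bar> + \<bar>g (a + b - t)\<bar> \<le> 2 * \<bar>g c\<bar>\<close> (lemma \<open>midpoint_bound_of_concave_powr\<close>). The integrand is
  thereby bounded pointwise, and the integral of \<open>(b - t) ^ n\<close> yields
  \[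
    \frac{(b - a)^{n+1}}{n!} \cdot \frac{1}{n + 1} \cdot |g(c)| .
  \]
  This is sharper than the claim: \<open>1 / (n + 1) \<le> (1 / (n * p + 1)) powr (1 / p)\<close> is Bernoulli's
  inequality \<open>1 + n * p \<le> (1 + n) powr p\<close> (lemma \<open>inverse_Suc_le_power_factor\<close>). The pointwise bound
  takes the place of Hoelder's inequality and the Hermite--Hadamard inequality, and it treats all
  \<open>q \<ge> 1\<close> alike.
\<close>

section \<open>The two forms of the constant\<close>

lemma Beta_one_right:
  fixes x :: real
  assumes "x > 0"
  shows "Beta x 1 = 1 / x"
proof -
  have "x \<notin> \<int>\<^sub>\<le>\<^sub>0" using assms by auto
  then have "Gamma (x + 1) = x * Gamma x" by (rule Gamma_plus1)
  with Gamma_real_pos[OF assms] show ?thesis by (simp add: Beta_def)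
qed

lemma Beta_factor_eq_power_factor:
  assumes "p \<ge> 0"
  shows "Beta_factor n p = power_factor n p"
proof -
  have "real n * real_of_ereal p + 1 > 0"
    using assms by (simp add: add_nonneg_pos real_of_ereal_pos)
  then show ?thesis
    by (simp add: Beta_factor_def power_factor_def Beta_one_right)
qed

lemma conjugate_exponent_ge_1:
  assumes "q \<ge> 1"
  shows "conjugate_exponent q \<ge> 1"
  using assms by (simp add: conjugate_exponent_def one_ereal_def divide_simps)

text \<open>
  For finite \<open>p\<close> this is Bernoulli's inequality in the form
  \<open>(n * p + 1) powr (1 / p) \<le> n + 1\<close>, which is the weighted inequality of arithmetic and geometric
  means for the numbers \<open>n * p + 1\<close> and \<open>1\<close> with the weights \<open>1 / p\<close> and \<open>1 - 1 / p\<close>.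
\<close>

lemma inverse_Suc_le_power_factor:
  assumes "p \<ge> 1"
  shows "1 / (real n + 1) \<le> power_factor n p"
proof (cases p)
  case (real r)
  with assms have r: "r \<ge> 1" by (simp add: one_ereal_def)
  then have pos: "real n * r + 1 > 0" by (simp add: add_nonneg_pos)
  have "(real n * r + 1) powr (1 / r) * 1 powr (1 - 1 / r)
      \<le> 1 / r * (real n * r + 1) + (1 - 1 / r) * 1"
    using r pos by (intro Youngs_inequality_0) auto
  also have "\<dots> = real n + 1" using r by (simp add: field_simps)
  finally have "1 / (real n + 1) \<le> 1 / (real n * r + 1) powr (1 / r)"
    using pos by (intro divide_left_mono) auto
  also have "\<dots> = (1 / (real n * r + 1)) powr (1 / r)"
    using pos by (simp add: powr_divide)
  finally show ?thesis using real by (simp add: power_factor_def)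
next
  case PInf
  then show ?thesis by (simp add: power_factor_def)
next
  case MInf
  with assms show ?thesis by simp
qed

section \<open>Symmetric points and the midpoint\<close>

text \<open>
  Convexity of \<open>x powr q\<close> on the closed half-line: the endpoint \<open>0\<close> matters, because \<open>u\<close> and \<open>v\<close>
  will be values of \<open>\<bar>g\<bar>\<close> and \<open>g\<close> may vanish. There the inequality reduces to \<open>2 \<le> 2 powr q\<close>.
\<close>

lemma midpoint_powr_le:
  fixes u v q :: real
  assumes "q \<ge> 1" "u \<ge> 0" "v \<ge> 0"
  shows "((u + v) / 2) powr q \<le> (u powr q + v powr q) / 2"
proof (cases "u = 0 \<or> v = 0")
  case True
  have "w powr q / 2 powr q \<le> w powr q / 2" for w :: real
    using assms(1) powr_mono[of 1 q 2] by (intro divide_left_mono) auto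
  with True assms show ?thesis by (auto simp: powr_divide)
next
  case False
  have "((1 - 1/2) *\<^sub>R u + (1/2) *\<^sub>R v) powr q \<le> (1 - 1/2) * u powr q + (1/2) * v powr q"
    using False assms by (intro convex_onD[OF powr_convex[OF assms(1)]]) auto
  then show ?thesis by (simp add: field_simps)
qed

lemma midpoint_bound_of_concave_powr:
  fixes g :: "real \<Rightarrow> real"
  assumes concave: "concave_on S (\<lambda>x. \<bar>g x\<bar> powr q)" and "q \<ge> 1" and "s \<in> S" "t \<in> S"
  shows "\<bar>g s\<bar> + \<bar>g t\<bar> \<le> 2 * \<bar>g ((s + t) / 2)\<bar>"
proof -
  have "((\<bar>g s\<bar> + \<bar>g t\<bar>) / 2) powr q \<le> (\<bar>g s\<bar> powr q + \<bar>g t\<bar> powr q) / 2"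
    using \<open>q \<ge> 1\<close> by (intro midpoint_powr_le) auto
  also have "\<dots> \<le> \<bar>g ((s + t) / 2)\<bar> powr q"
    using concave_onD[OF concave, of "1/2" s t] assms by (simp add: field_simps)
  finally have "(\<bar>g s\<bar> + \<bar>g t\<bar>) / 2 \<le> \<bar>g ((s + t) / 2)\<bar>"
    using \<open>q \<ge> 1\<close> by (smt (verit) powr_less_mono2)
  then show ?thesis by simp
qed

section \<open>Averaging the Taylor expansions from both endpoints\<close>

text \<open>
  The expansion from \<open>b\<close> to \<open>a\<close> is the forward expansion of \<open>t \<mapsto> D 0 (a + b - t)\<close>, whose derivatives
  are \<open>(-1) ^ m * D m (a + b - t)\<close>. Subtracting it from the forward expansion of \<open>D 0\<close> leaves both
  remainders with the same kernel. The remainders exist as Henstock--Kurzweil integrals because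
  their integrands are derivatives.
\<close>

lemma two_sided_Taylor_has_integral:
  fixes D :: "nat \<Rightarrow> real \<Rightarrow> real"
  assumes "a \<le> b"
    and D: "\<And>m t. m \<le> n \<Longrightarrow> t \<in> {a..b} \<Longrightarrow>
               (D m has_vector_derivative D (Suc m) t) (at t within {a..b})"
  shows "((\<lambda>t. (b - t) ^ n / fact n * (D (Suc n) t + (- 1) ^ n * D (Suc n) (a + b - t)))
           has_integral 2 * (D 0 b - D 0 a)
             - (\<Sum>m = 1..n. (b - a) ^ m / fact m * (D m a - (- 1) ^ m * D m b))) {a..b}"
proof -
  define E where "E m t = (- 1) ^ m * D m (a + b - t)" for m t
  have E: "(E m has_vector_derivative E (Suc m) t) (at t within {a..b})"
    if "m \<le> n" "t \<in> {a..b}" for m t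
  proof -
    have *: "(\<lambda>t. a + b - t) ` {a..b} = {a..b}" by (simp add: algebra_simps)
    have "(D m has_vector_derivative D (Suc m) (a + b - t))
            (at (a + b - t) within (\<lambda>t. a + b - t) ` {a..b})"
      unfolding * using that by (intro D) auto
    then have "(D m \<circ> (\<lambda>t. a + b - t) has_vector_derivative (- 1) *\<^sub>R D (Suc m) (a + b - t))
            (at t within {a..b})"
      by (intro vector_diff_chain_within) (auto intro!: derivative_eq_intros)
    from has_vector_derivative_mult_right[OF this, of "(- 1) ^ m"] show ?thesis
      by (simp add: E_def[abs_def] o_def)
  qed
  have split: "(\<Sum>i<Suc n. h i) = h 0 + (\<Sum>m = 1..n. h m)" for h :: "nat \<Rightarrow> real"
    by (simp add: lessThan_Suc_atMost atMost_atLeast0 sum.atLeast_Suc_atMost)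
  have 1: "((\<lambda>t. (b - t) ^ n / fact n * D (Suc n) t) has_integral
          D 0 b - (D 0 a + (\<Sum>m = 1..n. (b - a) ^ m / fact m * D m a))) {a..b}"
    using Taylor_has_integral[of "Suc n" D "D 0" a b] assms(1) D unfolding split by simp
  have 2: "((\<lambda>t. (b - t) ^ n / fact n * E (Suc n) t) has_integral
          E 0 b - (E 0 a + (\<Sum>m = 1..n. (b - a) ^ m / fact m * E m a))) {a..b}"
    using Taylor_has_integral[of "Suc n" E "E 0" a b] assms(1) E unfolding split by simp
  have sums: "(\<Sum>m = 1..n. (b - a) ^ m / fact m * (D m a - (- 1) ^ m * D m b))
      = (\<Sum>m = 1..n. (b - a) ^ m / fact m * D m a) - (\<Sum>m = 1..n. (b - a) ^ m / fact m * E m a)"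
    by (simp add: E_def right_diff_distrib sum_subtractf)
  from has_integral_diff[OF 1 2] show ?thesis
    unfolding sums by (simp add: E_def algebra_simps)
qed

lemma has_integral_right_distance_power:
  fixes a b :: real
  assumes "a \<le> b"
  shows "((\<lambda>t. (b - t) ^ n) has_integral (b - a) ^ (n + 1) / (real n + 1)) {a..b}"
proof -
  have "((\<lambda>t. - ((b - t) ^ Suc n / (real n + 1))) has_vector_derivative (b - t) ^ n)
          (at t within {a..b})" for t
  proof -
    have "((\<lambda>t. - ((b - t) ^ Suc n / (real n + 1))) has_real_derivative
             - (real (Suc n) * (b - t) ^ (Suc n - 1) * (- 1) / (real n + 1))) (at t within {a..b})"
      by (rule derivative_eq_intros refl | simp del: power_Suc)+
    then show ?thesis
      by (simp add: has_real_derivative_iff_has_vector_derivative add.commute)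
  qed
  from fundamental_theorem_of_calculus[OF assms this] show ?thesis by simp
qed

section \<open>The trapezoid inequality\<close>

text \<open>
  In the remainder the top derivative appears only as \<open>D n t + (-1) ^ n * D n (a + b - t)\<close>, so
  bounding \<open>\<bar>D n\<bar>\<close> on average over symmetric points bounds the integrand by a multiple of
  \<open>(b - t) ^ n\<close>. The constant \<open>1 / (n + 1)\<close> comes from the integral of that kernel.
\<close>

lemma trapezoid_error_bound:
  fixes D :: "nat \<Rightarrow> real \<Rightarrow> real"
  assumes "a \<le> b" and "n \<ge> 1"
    and D: "\<And>m t. m < n \<Longrightarrow> t \<in> {a..b} \<Longrightarrow>
               (D m has_vector_derivative D (Suc m) t) (at t within {a..b})"
    and bound: "\<And>t. t \<in> {a..b} \<Longrightarrow> \<bar>D n t\<bar> + \<bar>D n (a + b - t)\<bar> \<le> 2 * M"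
  shows "\<bar>(\<Sum>m = 1..n. (b - a) ^ m / (2 * fact m) * (D (m - 1) a - (- 1) ^ m * D (m - 1) b))
            - integral {a..b} (D 0)\<bar>
         \<le> (b - a) ^ (n + 1) / fact n * (1 / (real n + 1)) * M"
proof -
  \<comment> \<open>Prepending a primitive of \<open>D 0\<close> turns the integral into a difference of values.\<close>
  define F where "F = (\<lambda>x. integral {a..x} (D 0))"
  define G where "G = case_nat F D"
  have cont: "continuous_on {a..b} (D 0)"
    using D[of 0] \<open>n \<ge> 1\<close> by (intro continuous_on_vector_derivative) auto
  have G: "(G m has_vector_derivative G (Suc m) t) (at t within {a..b})"
    if "m \<le> n" "t \<in> {a..b}" for m t
    using that D integral_has_vector_derivative[OF cont]
    by (cases m) (auto simp: G_def F_def)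
  define S where "S = (\<Sum>m = 1..n. (b - a) ^ m / fact m * (D (m - 1) a - (- 1) ^ m * D (m - 1) b))"
  have S: "S = (\<Sum>m = 1..n. (b - a) ^ m / fact m * (G m a - (- 1) ^ m * G m b))"
    unfolding S_def by (intro sum.cong) (auto simp: G_def split: nat.split)
  have R: "((\<lambda>t. (b - t) ^ n / fact n * (D n t + (- 1) ^ n * D n (a + b - t)))
              has_integral 2 * integral {a..b} (D 0) - S) {a..b}"
    using two_sided_Taylor_has_integral[of a b n G, OF \<open>a \<le> b\<close> G] unfolding S by (simp add: G_def F_def)
  have B: "((\<lambda>t. (b - t) ^ n * (2 * M / fact n)) has_integral
              (b - a) ^ (n + 1) / (real n + 1) * (2 * M / fact n)) {a..b}"
    by (rule has_integral_mult_left[OF has_integral_right_distance_power[OF \<open>a \<le> b\<close>]])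
  have "norm (2 * integral {a..b} (D 0) - S) \<le> (b - a) ^ (n + 1) / (real n + 1) * (2 * M / fact n)"
  proof -
    have "norm ((b - t) ^ n / fact n * (D n t + (- 1) ^ n * D n (a + b - t)))
            \<le> (b - t) ^ n * (2 * M / fact n)" if "t \<in> {a..b}" for t
    proof -
      have "\<bar>D n t + (- 1) ^ n * D n (a + b - t)\<bar> \<le> \<bar>D n t\<bar> + \<bar>D n (a + b - t)\<bar>"
        by (rule order_trans[OF abs_triangle_ineq]) (simp add: abs_mult power_abs)
      also have "\<dots> \<le> 2 * M" using that by (rule bound)
      finally have "(b - t) ^ n / fact n * \<bar>D n t + (- 1) ^ n * D n (a + b - t)\<bar>
                      \<le> (b - t) ^ n / fact n * (2 * M)"
        using that by (intro mult_left_mono) auto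
      then show ?thesis using that by (simp add: abs_mult power_abs)
    qed
    then show ?thesis
      using integral_norm_bound_integral[OF has_integral_integrable[OF R] has_integral_integrable[OF B]]
      by (simp only: integral_unique[OF R] integral_unique[OF B])
  qed
  moreover have "(\<Sum>m = 1..n. (b - a) ^ m / (2 * fact m) * (D (m - 1) a - (- 1) ^ m * D (m - 1) b))
                   = S / 2"
    unfolding S_def sum_divide_distrib by (intro sum.cong) auto
  moreover have "(b - a) ^ (n + 1) / (real n + 1) * (2 * M / fact n)
                   = 2 * ((b - a) ^ (n + 1) / fact n * (1 / (real n + 1)) * M)"
    by (simp add: mult_ac)
  ultimately show ?thesis unfolding real_norm_def by linarith
qed

text \<open>
  The signs in the statement amount to the global factor \<open>- ((-1) ^ n)\<close>, which the absolute value
  removes.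
\<close>

lemma trapezoid_sum_sign:
  fixes A B :: "nat \<Rightarrow> real"
  shows "\<bar>(\<Sum>m = 1..n. (- 1) ^ (n - m + 2) * c m * (B m - (- 1) ^ m * A m)) + (- 1) ^ n * J\<bar>
       = \<bar>(\<Sum>m = 1..n. c m * (A m - (- 1) ^ m * B m)) - J\<bar>"
proof -
  have "(- 1) ^ (n - m + 2) * c m * (B m - (- 1) ^ m * A m)
          = - ((- 1) ^ n) * (c m * (A m - (- 1) ^ m * B m))" if "m \<in> {1..n}" for m
  proof -
    have "(- 1 :: real) ^ n = (- 1) ^ (n - m) * (- 1) ^ m"
      using that by (simp flip: power_add)
    moreover have "(- 1 :: real) ^ m * (- 1) ^ m = 1"
      by (simp flip: power_add)
    ultimately show ?thesis by (auto simp: algebra_simps)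
  qed
  then have "(\<Sum>m = 1..n. (- 1) ^ (n - m + 2) * c m * (B m - (- 1) ^ m * A m)) + (- 1) ^ n * J
      = - ((- 1) ^ n) * ((\<Sum>m = 1..n. c m * (A m - (- 1) ^ m * B m)) - J)"
    by (simp add: sum_distrib_left right_diff_distrib)
  then show ?thesis by (simp add: abs_mult power_abs)
qed

lemma nderiv_within_has_vector_derivative:
  assumes "n_times_differentiable_at_within n f x S" "k < n" "T \<subseteq> S"
  shows "(nderiv_within k S f has_vector_derivative nderiv_within (Suc k) S f x) (at x within T)"
proof -
  have "(nderiv_within k S f has_vector_derivative nderiv_within (Suc k) S f x) (at x within S)"
    using assms by (simp add: n_times_differentiable_at_within_def vector_derivative_works)
  then show ?thesis using assms(3) by (rule has_vector_derivative_within_subset)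
qed

theorem theorem8:
  fixes n :: nat and I :: "real set" and f :: "real \<Rightarrow> real" and a b q :: real and p :: ereal
  assumes "n \<ge> 1"
    and "is_interval I" and "I \<subseteq> {0..}"
    and "a \<in> I" and "b \<in> I" and "a < b"
    and "\<And>x. x \<in> interior I \<Longrightarrow> n_times_differentiable_at_within n f x I"
    and "\<And>x. x \<in> {a..b} \<Longrightarrow> n_times_differentiable_at_within n f x I"
    and "nderiv_within n I f absolutely_integrable_on {a..b}"
    and "q \<ge> 1" and "p = conjugate_exponent q"
    and "concave_on {a..b} (\<lambda>x. \<bar>nderiv_within n I f x\<bar> powr q)"
  shows "\<bar>(\<Sum>m = 1..n. (- 1) ^ (n - m + 2) * ((b - a) ^ m / (2 * fact m)) *
              (nderiv_within (m - 1) I f b - (- 1) ^ m * nderiv_within (m - 1) I f a))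
            + (- 1) ^ n * integral {a..b} f\<bar>
          \<le> (b - a) ^ (n + 1) / fact n * power_factor n p * \<bar>nderiv_within n I f ((a + b) / 2)\<bar>
       \<and> (b - a) ^ (n + 1) / fact n * power_factor n p * \<bar>nderiv_within n I f ((a + b) / 2)\<bar>
          = (b - a) ^ (n + 1) / fact n * Beta_factor n p * \<bar>nderiv_within n I f ((a + b) / 2)\<bar>"
proof -
  let ?D = "\<lambda>k. nderiv_within k I f"
  let ?M = "\<bar>?D n ((a + b) / 2)\<bar>"
  have "{a..b} \<subseteq> I"
    using assms(2,4,5) by (meson atLeastAtMost_iff mem_is_interval_1_I subsetI)
  with assms(8) have D: "(?D m has_vector_derivative ?D (Suc m) t) (at t within {a..b})"
    if "m < n" "t \<in> {a..b}" for m t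
    using that by (intro nderiv_within_has_vector_derivative)
  have bound: "\<bar>?D n t\<bar> + \<bar>?D n (a + b - t)\<bar> \<le> 2 * ?M" if "t \<in> {a..b}" for t
    using midpoint_bound_of_concave_powr[OF assms(12,10), of t "a + b - t"] that by simp
  have p: "p \<ge> 1"
    unfolding assms(11) using assms(10) by (rule conjugate_exponent_ge_1)
  have "\<bar>(\<Sum>m = 1..n. (b - a) ^ m / (2 * fact m) * (?D (m - 1) a - (- 1) ^ m * ?D (m - 1) b))
            - integral {a..b} (?D 0)\<bar>
        \<le> (b - a) ^ (n + 1) / fact n * (1 / (real n + 1)) * ?M"
    using assms(6,1) D bound by (intro trapezoid_error_bound) auto
  also have "\<dots> \<le> (b - a) ^ (n + 1) / fact n * power_factor n p * ?M"
    using \<open>a < b\<close> inverse_Suc_le_power_factor[OF p]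
    by (intro mult_right_mono mult_left_mono) auto
  finally have "\<bar>(\<Sum>m = 1..n. (- 1) ^ (n - m + 2) * ((b - a) ^ m / (2 * fact m)) *
              (?D (m - 1) b - (- 1) ^ m * ?D (m - 1) a)) + (- 1) ^ n * integral {a..b} f\<bar>
        \<le> (b - a) ^ (n + 1) / fact n * power_factor n p * ?M"
    unfolding trapezoid_sum_sign by simp
  moreover have "Beta_factor n p = power_factor n p"
    using p by (intro Beta_factor_eq_power_factor) (auto intro: order_trans[of 0 1])
  ultimately show ?thesis by simp
qed

end
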